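(* The retention function $\widetilde R_J$ satisfies the following properties. 1. $\widetilde R_J$ increases with rate lying in $(0,1]$; thus, $\widetilde R_J(y)$ and $y-\widetilde R_J(y)$ are non-decreasing functions of $y$. 2. $\widetilde R_J$ is concave, strictly for $y>\frac1{\rho_J}\ln(1+\theta)$. 3. $\widetilde R_J$ has the curvilinear asymptote $g$ given by $g(y)=\frac1{\rho_J}\ln(1+\theta+\eta y)$, and $\widetilde R_J(y)\le g(y)\wedge y$ for all $y\ge0$.
   Context: Data: $\lambda>0$, $\beta>0$ and $c$ are constants, and $\theta\ge0$, $\eta\ge0$ are the risk loadings of the mean-variance premium principle, under which the reinsurance premium rate for a retention function $R$ is $(1+\theta)\lambda\mathbb E(Y-R)+\frac{\eta}{2}\lambda\mathbb E((Y-R)^2)$. $Y$ is a positive random variable with cumulative distribution function $F_Y$ such that $F_Y(0)=0$ and $0<F_Y(y)<1$ for $y>0$; the moment generating function of $Y$ is finite in a neighborhood of $0$; $\mu=\mathbb{E}Y$ and $\sigma^2=\mathbb{E}(Y^2)$ (the second moment). It is assumed that $c>\lambda\mu$ and that $\kappa:=(1+\theta)\lambda\mu+\frac{\eta}{2}\lambda\sigma^2-c>0$. A retention function is a Borel function $R:[0,\infty)\to[0,\infty)$ with $0\le R(y)\le y$; $\mathbb E R=\mathbb E R(Y)$, etc., and $M_R(r)=\mathbb E(e^{rR(Y)})$. For a retention function $R$, $\rho(R)$ is the (unique, when it exists) positive solution $r$ of $[-\kappa+\lambda((1+\theta)\mathbb E R+\eta\mathbb E(YR)-\frac\eta2\mathbb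 E(R^2))]r-\frac12\beta^2r^2-\lambda(M_R(r)-1)=0$, and $\rho_J=\sup_R\rho(R)>0$ is the maximum adjustment coefficient. The maximizing retention function is $$\widetilde R_J(y)=\begin{cases}y,&0\le y<\frac1{\rho_J}\ln(1+\theta),\\ R_c(\rho_J,y),&y\ge\frac1{\rho_J}\ln(1+\theta),\end{cases}$$ where, for $r>0$ and $y\ge\frac1r\ln(1+\theta)$, $R_c(r,y)\in[0,y]$ is the unique solution $R$ of $(1+\theta)+\eta y-\eta R-e^{rR}=0$. "Rate" means the derivative with respect to $y$ (one-sided at $y=\frac1{\rho_J}\ln(1+\theta)$). That $g$ is a curvilinear asymptote of $\widetilde R_J$ means $\lim_{y\to\infty}\big(\widetilde R_J(y)-g(y)\big)=0$.
   Formalization: Positivity of the rate and strict concavity are claimed only for η>0; for η=0 they are false, since R̃_J(y)=min(y, ln(1+θ)/ρ_J) is constant beyond the threshold, and rates in [0,1] and plain concavity are claimed instead. *)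

theory Defs
  imports "HOL-Probability.Probability"
begin

definition retention_function :: "(real \<Rightarrow> real) \<Rightarrow> bool" where
  "retention_function R \<longleftrightarrow>
     R \<in> borel_measurable (restrict_space borel {0..}) \<and> (\<forall>y\<ge>0. 0 \<le> R y \<and> R y \<le> y)"

text \<open>
  The drift deficit \<open>\<kappa>\<close> of the surplus when all of the claim \<open>Y\<close> is reinsured. The last integral
  is the second moment of \<open>Y\<close>, not its variance.
\<close>

definition kappa :: "'a measure \<Rightarrow> ('a \<Rightarrow> real) \<Rightarrow> real \<Rightarrow> real \<Rightarrow> real \<Rightarrow> real \<Rightarrow> real" where
  "kappa M Y lam c \<theta> \<eta> =
     (1 + \<theta>) * lam * (LINT \<omega>|M. Y \<omega>) + \<eta> / 2 * lam * (LINT \<omega>|M. (Y \<omega>)\<^sup>2) - c"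

text \<open>
  \<open>r\<close> is a positive solution of the adjustment equation for \<open>R\<close>. The integrability condition says
  that \<open>M\<^sub>R(r)\<close> is finite; without it the Bochner integral would take the value \<open>0\<close>.
\<close>

definition is_adjustment_coefficient ::
    "'a measure \<Rightarrow> ('a \<Rightarrow> real) \<Rightarrow> real \<Rightarrow> real \<Rightarrow> real \<Rightarrow> real \<Rightarrow> real \<Rightarrow> (real \<Rightarrow> real) \<Rightarrow> real \<Rightarrow> bool" where
  "is_adjustment_coefficient M Y lam \<beta> c \<theta> \<eta> R r \<longleftrightarrow>
     r > 0 \<and>
     integrable M (\<lambda>\<omega>. exp (r * R (Y \<omega>))) \<and>
     (- kappa M Y lam c \<theta> \<eta>
        + lam * ((1 + \<theta>) * (LINT \<omega>|M. R (Y \<omega>))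
                 + \<eta> * (LINT \<omega>|M. Y \<omega> * R (Y \<omega>))
                 - \<eta> / 2 * (LINT \<omega>|M. (R (Y \<omega>))\<^sup>2))) * r
       - 1 / 2 * \<beta>\<^sup>2 * r\<^sup>2
       - lam * ((LINT \<omega>|M. exp (r * R (Y \<omega>))) - 1) = 0"

definition adjustment_coefficient ::
    "'a measure \<Rightarrow> ('a \<Rightarrow> real) \<Rightarrow> real \<Rightarrow> real \<Rightarrow> real \<Rightarrow> real \<Rightarrow> real \<Rightarrow> (real \<Rightarrow> real) \<Rightarrow> real" where
  "adjustment_coefficient M Y lam \<beta> c \<theta> \<eta> R =
     (THE r. is_adjustment_coefficient M Y lam \<beta> c \<theta> \<eta> R r)"

text \<open>
  The supremum ranges over the retention functions that have an adjustment coefficient. Under the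
  standing assumptions this set of reals is nonempty (take \<open>R y = min y m\<close> with \<open>m\<close> large) and
  bounded above by \<open>2 * c / \<beta>\<^sup>2\<close>, so the real supremum is the intended one.
\<close>

definition max_adjustment_coefficient ::
    "'a measure \<Rightarrow> ('a \<Rightarrow> real) \<Rightarrow> real \<Rightarrow> real \<Rightarrow> real \<Rightarrow> real \<Rightarrow> real \<Rightarrow> real" where
  "max_adjustment_coefficient M Y lam \<beta> c \<theta> \<eta> =
     Sup {adjustment_coefficient M Y lam \<beta> c \<theta> \<eta> R | R.
            retention_function R \<and> (\<exists>r. is_adjustment_coefficient M Y lam \<beta> c \<theta> \<eta> R r)}"

definition R_c :: "real \<Rightarrow> real \<Rightarrow> real \<Rightarrow> real \<Rightarrow> real" where
  "R_c \<theta> \<eta> r y =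
     (THE R. 0 \<le> R \<and> R \<le> y \<and> (1 + \<theta>) + \<eta> * y - \<eta> * R - exp (r * R) = 0)"

definition R_J ::
    "'a measure \<Rightarrow> ('a \<Rightarrow> real) \<Rightarrow> real \<Rightarrow> real \<Rightarrow> real \<Rightarrow> real \<Rightarrow> real \<Rightarrow> real \<Rightarrow> real" where
  "R_J M Y lam \<beta> c \<theta> \<eta> y =
     (let \<rho> = max_adjustment_coefficient M Y lam \<beta> c \<theta> \<eta>
      in if y < 1 / \<rho> * ln (1 + \<theta>) then y else R_c \<theta> \<eta> \<rho> y)"

text \<open>
  The function \<open>f\<close> on \<open>[0, \<infinity>)\<close> has a rate (derivative) at each point, with value in \<open>S\<close>; at the
  point \<open>t \<ge> 0\<close> both one-sided derivatives are considered instead. The left one is meaningful only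
  for \<open>t > 0\<close>, and at \<open>0\<close> every derivative is relative to \<open>[0, \<infinity>)\<close>.
\<close>

definition has_rates_in :: "(real \<Rightarrow> real) \<Rightarrow> real \<Rightarrow> real set \<Rightarrow> bool" where
  "has_rates_in f t S \<longleftrightarrow>
     (\<forall>y\<ge>0. y \<noteq> t \<longrightarrow> (\<exists>D\<in>S. (f has_real_derivative D) (at y within {0..}))) \<and>
     (\<exists>D\<in>S. (f has_real_derivative D) (at_right t)) \<and>
     (t > 0 \<longrightarrow> (\<exists>D\<in>S. (f has_real_derivative D) (at_left t)))"

definition strictly_concave_on :: "real set \<Rightarrow> (real \<Rightarrow> real) \<Rightarrow> bool" where
  "strictly_concave_on S f \<longleftrightarrow> convex S \<and>
     (\<forall>x\<in>S. \<forall>y\<in>S. \<forall>u. x \<noteq> y \<longrightarrow> 0 < u \<longrightarrow> u < 1 \<longrightarrow>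
        u * f x + (1 - u) * f y < f (u * x + (1 - u) * y))"

definition curvilinear_asymptote :: "(real \<Rightarrow> real) \<Rightarrow> (real \<Rightarrow> real) \<Rightarrow> bool" where
  "curvilinear_asymptote f g \<longleftrightarrow> ((\<lambda>y. f y - g y) \<longlongrightarrow> 0) at_top"

end

theory Submission
  imports Defs "HOL-Real_Asymp.Real_Asymp"
begin

text \<open>
  Positivity of \<open>\<rho>\<^sub>J\<close> is shown by truncated retention \<open>min y n\<close>: for large \<open>n\<close> the left side of
  the adjustment equation has slope close to \<open>c - \<lambda>\<mu> > 0\<close> at \<open>0\<close> and is eventually negative, so it
  has a positive root, and all roots are at most \<open>2c/\<beta>\<^sup>2\<close>.

  For the shape of \<open>R\<^sub>J\<close>, write \<open>\<rho> = \<rho>\<^sub>J\<close> and let \<open>H\<close> be the inverse of the increasing, strictly convex function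
  \<open>x \<mapsto> \<eta>x + e\<^bsup>\<rho>x\<^esup>\<close>; \<open>H\<close> is increasing and strictly concave on \<open>(0, \<infinity>)\<close>. Then
  \<open>R\<^sub>J(y) = min y (H(1 + \<theta> + \<eta>y))\<close> for \<open>y \<ge> 0\<close>, from which all three parts can be read off.
\<close>

section \<open>Positivity of the maximum adjustment coefficient\<close>

text \<open>Finiteness of the moment generating function near 0 enters in the form of two finite
  moments, which the final theorem derives from it.\<close>

locale reinsurance = prob_space M for M :: "'a measure" +
  fixes Y :: "'a \<Rightarrow> real" and lam \<beta> c \<theta> \<eta> :: real
  assumes Y_measurable [measurable]: "Y \<in> borel_measurable M"
    and Y_pos: "\<And>\<omega>. \<omega> \<in> space M \<Longrightarrow> Y \<omega> > 0"
    and Y_integrable: "integrable M Y"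
    and Y2_integrable: "integrable M (\<lambda>\<omega>. (Y \<omega>)\<^sup>2)"
    and lam_pos: "lam > 0" and beta_pos: "\<beta> > 0"
    and theta_nonneg: "\<theta> \<ge> 0" and eta_nonneg: "\<eta> \<ge> 0"
    and net_profit: "c > lam * (LINT \<omega>|M. Y \<omega>)"
begin

text \<open>For a retention function this is the premium rate left after reinsurance: expand the
  square in the premium for the ceded part \<open>Y - R(Y)\<close> and subtract from
  \<open>c\<close>.\<close>

definition drift :: "(real \<Rightarrow> real) \<Rightarrow> real" where
  "drift R = - kappa M Y lam c \<theta> \<eta>
     + lam * ((1 + \<theta>) * (LINT \<omega>|M. R (Y \<omega>))
              + \<eta> * (LINT \<omega>|M. Y \<omega> * R (Y \<omega>))
              - \<eta> / 2 * (LINT \<omega>|M. (R (Y \<omega>))\<^sup>2))"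

definition retained_mgf :: "(real \<Rightarrow> real) \<Rightarrow> real \<Rightarrow> real" where
  "retained_mgf R r = (LINT \<omega>|M. exp (r * R (Y \<omega>)))"

section \<open>Moments of the retained claim\<close>

lemma Y_nonneg: "\<omega> \<in> space M \<Longrightarrow> 0 \<le> Y \<omega>"
  using Y_pos by (simp add: less_imp_le)

lemma is_adjustment_coefficient_iff:
  "is_adjustment_coefficient M Y lam \<beta> c \<theta> \<eta> R r \<longleftrightarrow>
     r > 0 \<and> integrable M (\<lambda>\<omega>. exp (r * R (Y \<omega>))) \<and>
     drift R * r - 1 / 2 * \<beta>\<^sup>2 * r\<^sup>2 - lam * (retained_mgf R r - 1) = 0"
  unfolding is_adjustment_coefficient_def drift_def retained_mgf_def by (rule refl)

lemma retained_measurable: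
  assumes "retention_function R"
  shows "(\<lambda>\<omega>. R (Y \<omega>)) \<in> borel_measurable M"
proof -
  have "Y \<in> measurable M (restrict_space borel {0..})"
    using Y_pos by (intro measurable_restrict_space2) (auto intro: less_imp_le)
  moreover have "R \<in> borel_measurable (restrict_space borel {0..})"
    using assms by (simp add: retention_function_def)
  ultimately show ?thesis
    by (rule measurable_compose)
qed

lemma retained_bounds:
  assumes "retention_function R" "\<omega> \<in> space M"
  shows "0 \<le> R (Y \<omega>)" "R (Y \<omega>) \<le> Y \<omega>"
  using assms Y_pos[of \<omega>] by (auto simp: retention_function_def)

lemma retained_integrable:
  assumes "retention_function R"
  shows "integrable M (\<lambda>\<omega>. R (Y \<omega>))" "integrable M (\<lambda>\<omega>. Y \<omega> * R (Y \<omega>))"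
    "integrable M (\<lambda>\<omega>. (R (Y \<omega>))\<^sup>2)"
proof -
  note [measurable] = retained_measurable[OF assms]
  show "integrable M (\<lambda>\<omega>. R (Y \<omega>))"
    by (rule Bochner_Integration.integrable_bound[OF Y_integrable])
      (auto intro!: AE_I2 simp: retained_bounds[OF assms] intro: order_trans[OF _ abs_ge_self])
  show "integrable M (\<lambda>\<omega>. Y \<omega> * R (Y \<omega>))"
    by (rule Bochner_Integration.integrable_bound[OF Y2_integrable])
      (auto intro!: AE_I2 mult_left_mono
        simp: retained_bounds[OF assms] Y_nonneg power2_eq_square abs_mult)
  show "integrable M (\<lambda>\<omega>. (R (Y \<omega>))\<^sup>2)"
    by (rule Bochner_Integration.integrable_bound[OF Y2_integrable])
      (auto intro!: AE_I2 power_mono simp: retained_bounds[OF assms])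
qed

section \<open>Upper bound and uniqueness of the adjustment coefficient\<close>

lemma retained_mgf_ge_1:
  assumes "retention_function R" "r \<ge> 0" "integrable M (\<lambda>\<omega>. exp (r * R (Y \<omega>)))"
  shows "1 \<le> retained_mgf R r"
proof -
  have "(LINT \<omega>|M. 1) \<le> (LINT \<omega>|M. exp (r * R (Y \<omega>)))"
    using assms by (intro integral_mono) (auto simp: retained_bounds)
  then show ?thesis
    by (simp add: retained_mgf_def prob_space)
qed

text \<open>The reinsurance premium is nonnegative: its linear part because
  \<open>R(Y) \<le> Y\<close>, its quadratic part because
  \<open>(Y - R(Y))^2 \<ge> 0\<close>.\<close>

lemma drift_le:
  assumes "retention_function R"
  shows "drift R \<le> c"
proof -
  note int = retained_integrable[OF assms]
  have "(LINT \<omega>|M. Y \<omega> * R (Y \<omega>)) - 1 / 2 * (LINT \<omega>|M. (R (Y \<omega>))\<^sup>2)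
      = (LINT \<omega>|M. Y \<omega> * R (Y \<omega>) - 1 / 2 * (R (Y \<omega>))\<^sup>2)"
    using int by simp
  also have "\<dots> \<le> (LINT \<omega>|M. 1 / 2 * (Y \<omega>)\<^sup>2)"
  proof (rule integral_mono)
    fix \<omega>
    have "0 \<le> (Y \<omega> - R (Y \<omega>))\<^sup>2" by simp
    then show "Y \<omega> * R (Y \<omega>) - 1 / 2 * (R (Y \<omega>))\<^sup>2 \<le> 1 / 2 * (Y \<omega>)\<^sup>2"
      by (simp add: power2_diff)
  qed (use int Y2_integrable in simp_all)
  finally have second: "(LINT \<omega>|M. Y \<omega> * R (Y \<omega>)) - 1 / 2 * (LINT \<omega>|M. (R (Y \<omega>))\<^sup>2)
      \<le> 1 / 2 * (LINT \<omega>|M. (Y \<omega>)\<^sup>2)" by simp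
  have first: "(LINT \<omega>|M. R (Y \<omega>)) \<le> (LINT \<omega>|M. Y \<omega>)"
    using int Y_integrable by (intro integral_mono) (auto simp: retained_bounds[OF assms])
  have "(1 + \<theta>) * (LINT \<omega>|M. R (Y \<omega>))
      + \<eta> * ((LINT \<omega>|M. Y \<omega> * R (Y \<omega>)) - 1 / 2 * (LINT \<omega>|M. (R (Y \<omega>))\<^sup>2))
    \<le> (1 + \<theta>) * (LINT \<omega>|M. Y \<omega>) + \<eta> * (1 / 2 * (LINT \<omega>|M. (Y \<omega>)\<^sup>2))"
    using theta_nonneg eta_nonneg by (intro add_mono mult_left_mono first second) auto
  from mult_left_mono[OF this less_imp_le[OF lam_pos]]
  show ?thesis
    by (simp add: drift_def kappa_def algebra_simps)
qed

text \<open>Since the generating function is at least 1, the equation forces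
  \<open>1/2 \<beta>^2 r^2 \<le> drift R * r \<le> c r\<close>.\<close>

lemma adjustment_coefficient_le:
  assumes "retention_function R" "is_adjustment_coefficient M Y lam \<beta> c \<theta> \<eta> R r"
  shows "r \<le> 2 * c / \<beta>\<^sup>2"
proof -
  have r: "r > 0" "integrable M (\<lambda>\<omega>. exp (r * R (Y \<omega>)))"
    and eq: "drift R * r - 1 / 2 * \<beta>\<^sup>2 * r\<^sup>2 - lam * (retained_mgf R r - 1) = 0"
    using assms(2) by (auto simp: is_adjustment_coefficient_iff)
  have "0 \<le> lam * (retained_mgf R r - 1)"
    using retained_mgf_ge_1[OF assms(1) less_imp_le[OF r(1)] r(2)] lam_pos by simp
  then have "1 / 2 * \<beta>\<^sup>2 * r * r \<le> drift R * r"
    using eq by (simp add: power2_eq_square)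
  then have "1 / 2 * \<beta>\<^sup>2 * r \<le> drift R"
    using r(1) by simp
  then have "\<beta>\<^sup>2 * r \<le> 2 * c"
    using drift_le[OF assms(1)] by simp
  then show ?thesis
    using beta_pos by (simp add: field_simps)
qed

text \<open>The left side of the adjustment equation is strictly concave in \<open>r\<close>, thanks
  to the term with \<open>\<beta>\<close>, and vanishes at 0; hence it has at most one positive
  root.\<close>

lemma adjustment_coefficient_not_less:
  assumes "retention_function R"
    and "is_adjustment_coefficient M Y lam \<beta> c \<theta> \<eta> R r"
    and "is_adjustment_coefficient M Y lam \<beta> c \<theta> \<eta> R q"
  shows "\<not> r < q"
proof
  assume "r < q"
  \<comment> \<open>The smaller root \<open>r\<close> is the convex combination of 0 and
    \<open>q\<close> with weight \<open>s\<close> on \<open>q\<close>.\<close>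
  define s where "s = r / q"
  have pos: "r > 0" "q > 0"
    and int: "integrable M (\<lambda>\<omega>. exp (r * R (Y \<omega>)))" "integrable M (\<lambda>\<omega>. exp (q * R (Y \<omega>)))"
    and eq: "drift R * r - 1 / 2 * \<beta>\<^sup>2 * r\<^sup>2 - lam * (retained_mgf R r - 1) = 0"
      "drift R * q - 1 / 2 * \<beta>\<^sup>2 * q\<^sup>2 - lam * (retained_mgf R q - 1) = 0"
    using assms(2,3) by (auto simp: is_adjustment_coefficient_iff)
  have s: "0 < s" "s < 1" "r = s * q"
    using pos \<open>r < q\<close> by (auto simp: s_def)
  have "retained_mgf R r \<le> (LINT \<omega>|M. (1 - s) + s * exp (q * R (Y \<omega>)))"
    unfolding retained_mgf_def
  proof (rule integral_mono)
    fix \<omega>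
    show "exp (r * R (Y \<omega>)) \<le> (1 - s) + s * exp (q * R (Y \<omega>))"
      using convex_onD[OF exp_convex, of s 0 "q * R (Y \<omega>)"] s by (simp add: mult.assoc)
  qed (use int in simp_all)
  also have "\<dots> = (1 - s) + s * retained_mgf R q"
    using int by (simp add: retained_mgf_def prob_space)
  finally have "retained_mgf R r - 1 \<le> s * (retained_mgf R q - 1)"
    by (simp add: algebra_simps)
  from mult_left_mono[OF this less_imp_le[OF lam_pos]]
  have "lam * (retained_mgf R r - 1) \<le> s * (lam * (retained_mgf R q - 1))"
    by (simp add: mult.left_commute)
  also have "\<dots> = s * (drift R * q - 1 / 2 * \<beta>\<^sup>2 * q\<^sup>2)"
    using eq(2) by simp
  finally have "drift R * r - 1 / 2 * \<beta>\<^sup>2 * r\<^sup>2 \<le> s * (drift R * q - 1 / 2 * \<beta>\<^sup>2 * q\<^sup>2)"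
    using eq(1) by simp
  \<comment> \<open>The drift terms cancel because \<open>r = s * q\<close>; only the gap between
    \<open>s\<close> and \<open>s^2\<close> in the quadratic terms remains.\<close>
  then have "\<beta>\<^sup>2 * q\<^sup>2 * (s * (1 - s)) \<le> 0"
    by (simp add: s(3) power2_eq_square algebra_simps)
  moreover have "\<beta>\<^sup>2 * q\<^sup>2 * (s * (1 - s)) > 0"
    using s pos beta_pos by simp
  ultimately show False by simp
qed

lemma adjustment_coefficient_eq:
  assumes "retention_function R" "is_adjustment_coefficient M Y lam \<beta> c \<theta> \<eta> R r"
  shows "adjustment_coefficient M Y lam \<beta> c \<theta> \<eta> R = r"
  unfolding adjustment_coefficient_def
proof (rule the_equality)
  fix q assume "is_adjustment_coefficient M Y lam \<beta> c \<theta> \<eta> R q"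
  then show "q = r"
    using adjustment_coefficient_not_less[OF assms(1)] assms(2) by (meson linorder_neqE)
qed fact

text \<open>The uniform bound \<open>2 * c / \<beta>^2\<close> makes the real supremum a genuine
  upper bound.\<close>

lemma max_adjustment_coefficient_ge:
  assumes "retention_function R" "is_adjustment_coefficient M Y lam \<beta> c \<theta> \<eta> R r"
  shows "r \<le> max_adjustment_coefficient M Y lam \<beta> c \<theta> \<eta>"
  unfolding max_adjustment_coefficient_def
proof (rule cSup_upper)
  show "bdd_above {adjustment_coefficient M Y lam \<beta> c \<theta> \<eta> R | R.
      retention_function R \<and> (\<exists>r. is_adjustment_coefficient M Y lam \<beta> c \<theta> \<eta> R r)}"
    by (rule bdd_aboveI[where M = "2 * c / \<beta>\<^sup>2"])
      (auto simp: adjustment_coefficient_eq adjustment_coefficient_le)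
  show "r \<in> {adjustment_coefficient M Y lam \<beta> c \<theta> \<eta> R | R.
      retention_function R \<and> (\<exists>r. is_adjustment_coefficient M Y lam \<beta> c \<theta> \<eta> R r)}"
    using assms adjustment_coefficient_eq[OF assms, symmetric] by blast
qed

section \<open>Existence of an adjustment coefficient by truncation\<close>

lemma retention_function_min:
  assumes "m \<ge> 0"
  shows "retention_function (\<lambda>y. min y m)"
  using assms unfolding retention_function_def
  by (auto intro!: measurable_restrict_space1)

text \<open>The sequence consists of the slopes at 0 of the left side of the adjustment equation. By
  dominated convergence they tend to the slope for full retention, whose drift is
  \<open>c\<close>.\<close>

lemma drift_min_tendsto:
  "(\<lambda>n. drift (\<lambda>y. min y (real n)) - lam * (LINT \<omega>|M. min (Y \<omega>) (real n)))
     \<longlonglongrightarrow> c - lam * (LINT \<omega>|M. Y \<omega>)"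
proof -
  have lim: "(\<lambda>n. min (Y \<omega>) (real n)) \<longlonglongrightarrow> Y \<omega>" for \<omega>
  proof (rule tendsto_eventually)
    obtain N where "Y \<omega> < real N"
      using reals_Archimedean2 by blast
    then show "\<forall>\<^sub>F n in sequentially. min (Y \<omega>) (real n) = Y \<omega>"
      by (intro eventually_sequentiallyI[of N]) simp
  qed
  have 1: "(\<lambda>n. LINT \<omega>|M. min (Y \<omega>) (real n)) \<longlonglongrightarrow> (LINT \<omega>|M. Y \<omega>)"
    by (rule integral_dominated_convergence[where w = Y])
      (auto intro!: AE_I2 Y_integrable lim simp: Y_nonneg)
  have 2: "(\<lambda>n. LINT \<omega>|M. Y \<omega> * min (Y \<omega>) (real n)) \<longlonglongrightarrow> (LINT \<omega>|M. Y \<omega> * Y \<omega>)"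
    by (rule integral_dominated_convergence[where w = "\<lambda>\<omega>. Y \<omega> * Y \<omega>"])
      (auto intro!: AE_I2 Y2_integrable[unfolded power2_eq_square] tendsto_mult lim mult_left_mono
        simp: Y_nonneg abs_mult)
  have 3: "(\<lambda>n. LINT \<omega>|M. (min (Y \<omega>) (real n))\<^sup>2) \<longlonglongrightarrow> (LINT \<omega>|M. (Y \<omega>)\<^sup>2)"
    by (rule integral_dominated_convergence[where w = "\<lambda>\<omega>. (Y \<omega>)\<^sup>2"])
      (auto intro!: AE_I2 Y2_integrable tendsto_power lim power_mono simp: Y_nonneg)
  have "(\<lambda>n. drift (\<lambda>y. min y (real n)) - lam * (LINT \<omega>|M. min (Y \<omega>) (real n)))
     \<longlonglongrightarrow> - kappa M Y lam c \<theta> \<eta> + lam * ((1 + \<theta>) * (LINT \<omega>|M. Y \<omega>)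
              + \<eta> * (LINT \<omega>|M. Y \<omega> * Y \<omega>)
              - \<eta> / 2 * (LINT \<omega>|M. (Y \<omega>)\<^sup>2)) - lam * (LINT \<omega>|M. Y \<omega>)"
    unfolding drift_def by (intro tendsto_intros 1 2 3)
  then show ?thesis
    by (simp add: kappa_def power2_eq_square algebra_simps)
qed

lemma retained_min_exp_integrable:
  assumes "m \<ge> 0"
  shows "integrable M (\<lambda>\<omega>. exp (r * min (Y \<omega>) m))"
proof (rule integrable_const_bound[where B = "exp (\<bar>r\<bar> * m)"])
  have "r * min (Y \<omega>) m \<le> \<bar>r\<bar> * m" if "\<omega> \<in> space M" for \<omega>
    using Y_pos[OF that] assms by (intro mult_mono) auto
  then show "AE \<omega> in M. norm (exp (r * min (Y \<omega>) m)) \<le> exp (\<bar>r\<bar> * m)"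
    by (intro AE_I2) simp
qed simp

text \<open>Truncation makes the generating function finite on the whole line, and a finite convex
  function on an open set is continuous.\<close>

lemma retained_min_mgf_continuous:
  assumes "m \<ge> 0"
  shows "continuous_on UNIV (retained_mgf (\<lambda>y. min y m))"
proof -
  note int = retained_min_exp_integrable[OF assms]
  have "convex_on UNIV (retained_mgf (\<lambda>y. min y m))"
  proof (rule convex_onI)
    fix u r q :: real
    assume u: "0 < u" "u < 1"
    have "retained_mgf (\<lambda>y. min y m) ((1 - u) *\<^sub>R r + u *\<^sub>R q)
        \<le> (LINT \<omega>|M. (1 - u) * exp (r * min (Y \<omega>) m) + u * exp (q * min (Y \<omega>) m))"
      unfolding retained_mgf_def
    proof (rule integral_mono)
      fix \<omega>
      show "exp (((1 - u) *\<^sub>R r + u *\<^sub>R q) * min (Y \<omega>) m)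
          \<le> (1 - u) * exp (r * min (Y \<omega>) m) + u * exp (q * min (Y \<omega>) m)"
        using convex_onD[OF exp_convex, of u "r * min (Y \<omega>) m" "q * min (Y \<omega>) m"] u
        by (simp add: algebra_simps)
    qed (use int in simp_all)
    then show "retained_mgf (\<lambda>y. min y m) ((1 - u) *\<^sub>R r + u *\<^sub>R q)
        \<le> (1 - u) * retained_mgf (\<lambda>y. min y m) r + u * retained_mgf (\<lambda>y. min y m) q"
      using int by (simp add: retained_mgf_def)
  qed simp
  then show ?thesis
    by (intro convex_on_continuous) auto
qed

text \<open>For \<open>r \<le> 1 / m\<close> the exponent stays in [0,1], where
  \<open>exp x \<le> 1 + x + x^2\<close>.\<close>

lemma retained_min_mgf_le:
  assumes "m > 0" "0 \<le> r" "r \<le> 1 / m"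
  shows "retained_mgf (\<lambda>y. min y m) r \<le> 1 + r * (LINT \<omega>|M. min (Y \<omega>) m) + (r * m)\<^sup>2"
proof -
  note int = retained_integrable(1)[OF retention_function_min[OF less_imp_le[OF assms(1)]]]
  have "retained_mgf (\<lambda>y. min y m) r \<le> (LINT \<omega>|M. 1 + r * min (Y \<omega>) m + (r * m)\<^sup>2)"
    unfolding retained_mgf_def
  proof (rule integral_mono)
    fix \<omega> assume "\<omega> \<in> space M"
    then have le: "0 \<le> r * min (Y \<omega>) m" "r * min (Y \<omega>) m \<le> r * m"
      using Y_pos[of \<omega>] assms by (auto intro!: mult_left_mono)
    have "r * m \<le> 1"
      using assms by (simp add: field_simps)
    then have "exp (r * min (Y \<omega>) m) \<le> 1 + r * min (Y \<omega>) m + (r * min (Y \<omega>) m)\<^sup>2"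
      using le by (intro exp_bound) auto
    also have "\<dots> \<le> 1 + r * min (Y \<omega>) m + (r * m)\<^sup>2"
      using le by (intro add_left_mono power_mono) auto
    finally show "exp (r * min (Y \<omega>) m) \<le> 1 + r * min (Y \<omega>) m + (r * m)\<^sup>2" .
  qed (use int retained_min_exp_integrable[of m] assms in simp_all)
  then show ?thesis
    using int by (simp add: prob_space)
qed

lemma adjustment_coefficient_exists:
  "\<exists>m\<ge>0. \<exists>r. is_adjustment_coefficient M Y lam \<beta> c \<theta> \<eta> (\<lambda>y. min y m) r"
proof -
  have "\<forall>\<^sub>F n in sequentially.
      0 < drift (\<lambda>y. min y (real n)) - lam * (LINT \<omega>|M. min (Y \<omega>) (real n)) \<and> n > 0"
    using net_profit
    by (intro eventually_conj order_tendstoD(1)[OF drift_min_tendsto] eventually_gt_at_top) simp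
  from eventually_happens'[OF _ this] obtain n :: nat
    where n: "n > 0" "0 < drift (\<lambda>y. min y (real n)) - lam * (LINT \<omega>|M. min (Y \<omega>) (real n))"
    by auto
  define m where "m = real n"
  define A where "A = drift (\<lambda>y. min y m)"
  define E where "E = (LINT \<omega>|M. min (Y \<omega>) m)"
  define G where "G = retained_mgf (\<lambda>y. min y m)"
  define f where "f r = A * r - 1 / 2 * \<beta>\<^sup>2 * r\<^sup>2 - lam * (G r - 1)" for r
  have m: "m > 0" and slope: "A - lam * E > 0"
    using n by (auto simp: m_def A_def E_def)
  note ret = retention_function_min[OF less_imp_le[OF m]]
  \<comment> \<open>\<open>K\<close> collects the quadratic terms: on \<open>[0, 1/m]\<close> the
    bound on the generating function gives \<open>f r \<ge> r * ((A - lam * E) - r * K)\<close>, and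
    \<open>a\<close> is chosen to keep this nonnegative.\<close>
  define K where "K = 1 / 2 * \<beta>\<^sup>2 + lam * m\<^sup>2"
  have K: "K > 0"
    using beta_pos lam_pos by (simp add: K_def add_pos_nonneg)
  define a where "a = min (1 / m) ((A - lam * E) / K)"
  have a: "a > 0" "a \<le> 1 / m" "a * K \<le> A - lam * E"
    using m slope K by (auto simp: a_def min_def field_simps)
  have "lam * (G a - 1) \<le> lam * (a * E + (a * m)\<^sup>2)"
    using retained_min_mgf_le[of m a] m a lam_pos by (intro mult_left_mono) (auto simp: G_def E_def)
  then have "f a \<ge> a * ((A - lam * E) - a * K)"
    by (simp add: f_def K_def algebra_simps power2_eq_square)
  moreover have "a * ((A - lam * E) - a * K) \<ge> 0"
    using a by simp
  ultimately have fa: "f a \<ge> 0" by simp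
  \<comment> \<open>Beyond the general bound on roots the quadratic term outweighs the drift, so
    \<open>f\<close> is nonpositive at \<open>b\<close>. Starting the interval at
    \<open>a > 0\<close> excludes the trivial root 0.\<close>
  define b where "b = max a (2 * c / \<beta>\<^sup>2)"
  have b: "a \<le> b" "2 * c \<le> \<beta>\<^sup>2 * b"
    using beta_pos by (auto simp: b_def field_simps max_def)
  have "lam * (G b - 1) \<ge> 0"
    using retained_mgf_ge_1[OF ret _ retained_min_exp_integrable] a b m lam_pos
    by (simp add: G_def)
  moreover have "A * b \<le> c * b"
    using drift_le[OF ret] a b by (intro mult_right_mono) (auto simp: A_def)
  moreover have "2 * c * b \<le> \<beta>\<^sup>2 * b * b"
    using a b by (intro mult_right_mono) auto
  ultimately have fb: "f b \<le> 0"
    by (simp add: f_def power2_eq_square)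
  have "continuous_on {a..b} f"
    unfolding f_def G_def
    by (intro continuous_intros continuous_on_subset[OF retained_min_mgf_continuous])
      (use m in auto)
  from IVT2'[OF fb fa b(1) this] obtain r where "a \<le> r" "f r = 0"
    by auto
  then have "is_adjustment_coefficient M Y lam \<beta> c \<theta> \<eta> (\<lambda>y. min y m) r"
    using a m retained_min_exp_integrable[of m r]
    by (simp add: is_adjustment_coefficient_iff f_def A_def G_def)
  then show ?thesis
    using m by (intro exI[of _ m]) auto
qed

lemma max_adjustment_coefficient_pos: "max_adjustment_coefficient M Y lam \<beta> c \<theta> \<eta> > 0"
proof -
  obtain m r where m: "m \<ge> 0"
    and r: "is_adjustment_coefficient M Y lam \<beta> c \<theta> \<eta> (\<lambda>y. min y m) r"
    using adjustment_coefficient_exists by blast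
  then show ?thesis
    using max_adjustment_coefficient_ge[OF retention_function_min[OF m] r]
    by (simp add: is_adjustment_coefficient_def)
qed

end

section \<open>The shape of the maximizing retention function\<close>

text \<open>Average the strict tangent inequality \<open>1 + w < exp w\<close> at
  \<open>w = x - z\<close> and \<open>w = y - z\<close>, where the linear terms cancel, and multiply
  by \<open>exp z\<close>.\<close>

lemma exp_strictly_convex:
  fixes x y u :: real
  assumes "x \<noteq> y" "0 < u" "u < 1"
  shows "exp (u * x + (1 - u) * y) < u * exp x + (1 - u) * exp y"
proof -
  define z where "z = u * x + (1 - u) * y"
  have less: "1 + w < exp w" if "w \<noteq> 0" for w :: real
  proof -
    have "exp w \<noteq> 1 + w"
      using that ln_eq_minus_one[OF exp_gt_zero, of w] by auto
    then show ?thesis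
      using exp_ge_add_one_self[of w] by linarith
  qed
  have "x - z = (1 - u) * (x - y)" "y - z = u * (y - x)"
    by (auto simp: z_def algebra_simps)
  then have "x - z \<noteq> 0" "y - z \<noteq> 0"
    using assms by auto
  then have "u * (1 + (x - z)) + (1 - u) * (1 + (y - z)) < u * exp (x - z) + (1 - u) * exp (y - z)"
    using assms by (intro add_strict_mono mult_strict_left_mono less) auto
  moreover have "u * (1 + (x - z)) + (1 - u) * (1 + (y - z)) = 1"
    by (simp add: z_def algebra_simps)
  ultimately have "exp z * 1 < exp z * (u * exp (x - z) + (1 - u) * exp (y - z))"
    by (intro mult_strict_left_mono) auto
  also have "\<dots> = u * exp x + (1 - u) * exp y"
    by (simp add: exp_diff field_simps)
  finally show ?thesis
    by (simp add: z_def)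
qed

text \<open>The shape depends on \<open>\<rho>\<^sub>J\<close> only through its positivity, so
  \<open>\<rho>\<close> is an arbitrary positive number here.\<close>

locale retention_shape =
  fixes \<rho> \<theta> \<eta> :: real
  assumes rho_pos: "\<rho> > 0" and theta_nonneg: "\<theta> \<ge> 0" and eta_nonneg: "\<eta> \<ge> 0"
begin

section \<open>The function \<open>G\<close> and its inverse\<close>

definition G :: "real \<Rightarrow> real" where
  "G x = \<eta> * x + exp (\<rho> * x)"

text \<open>For \<open>\<eta> = 0\<close> the range of \<open>G\<close> is the positive half-line,
  so values of \<open>H\<close> are used at positive arguments only.\<close>

definition H :: "real \<Rightarrow> real" where
  "H s = (THE x. G x = s)"

lemma G_strict_mono: "strict_mono G"
  using rho_pos eta_nonneg
  by (auto intro!: strict_monoI add_le_less_mono mult_left_mono simp: G_def)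

lemma G_less_iff: "G x < G y \<longleftrightarrow> x < y"
  and G_le_iff: "G x \<le> G y \<longleftrightarrow> x \<le> y"
  using G_strict_mono by (auto simp: strict_mono_less strict_mono_less_eq)

lemma H_G: "H (G x) = x"
  unfolding H_def using strict_mono_eq[OF G_strict_mono] by (intro the_equality) auto

lemma G_H:
  assumes "s > 0"
  shows "G (H s) = s"
proof -
  \<comment> \<open>Here \<open>G 0 = 1\<close> and
    \<open>G (ln s / \<rho>) = s + \<eta> * ln s / \<rho>\<close>. These two values enclose
    \<open>s\<close>, in an order that depends on the sign of \<open>ln s\<close>;
    \<open>min\<close> and \<open>max\<close> cover both cases.\<close>
  have "continuous_on {min 0 (ln s / \<rho>)..max 0 (ln s / \<rho>)} G"
    unfolding G_def by (intro continuous_intros)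
  moreover have "G (min 0 (ln s / \<rho>)) \<le> s"
  proof (cases "ln s \<le> 0")
    case True
    then have "ln s / \<rho> \<le> 0" using rho_pos by (simp add: divide_nonpos_pos)
    then show ?thesis
      using assms rho_pos eta_nonneg mult_nonneg_nonpos[of \<eta> "ln s / \<rho>"] by (simp add: G_def min_def)
  next
    case False
    then show ?thesis using assms rho_pos by (auto simp: G_def min_def field_simps)
  qed
  moreover have "s \<le> G (max 0 (ln s / \<rho>))"
  proof (cases "ln s \<ge> 0")
    case True
    then have "ln s / \<rho> \<ge> 0" using rho_pos by simp
    then show ?thesis
      using assms rho_pos eta_nonneg mult_nonneg_nonneg[of \<eta> "ln s / \<rho>"] by (simp add: G_def max_def)
  next
    case False
    then show ?thesis using assms rho_pos by (auto simp: G_def max_def field_simps)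
  qed
  moreover have "min 0 (ln s / \<rho>) \<le> max 0 (ln s / \<rho>)"
    by linarith
  ultimately obtain x where "G x = s"
    using IVT'[of G "min 0 (ln s / \<rho>)" s "max 0 (ln s / \<rho>)"] by blast
  then show ?thesis
    using H_G by metis
qed

lemma H_has_derivative:
  assumes "s > 0"
  shows "(H has_real_derivative inverse (\<eta> + \<rho> * exp (\<rho> * H s))) (at s)"
proof -
  have "(G has_real_derivative \<eta> + \<rho> * exp (\<rho> * H s)) (at (H s))"
    unfolding G_def by (auto intro!: derivative_eq_intros)
  moreover have "\<eta> + \<rho> * exp (\<rho> * H s) \<noteq> 0"
    using rho_pos eta_nonneg by (simp add: add_nonneg_pos less_imp_neq[symmetric])
  moreover have "continuous_on UNIV G"
    unfolding G_def by (intro continuous_intros)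
  ultimately have "(H has_real_derivative inverse (\<eta> + \<rho> * exp (\<rho> * H s))) (at (G (H s)))"
    unfolding has_field_derivative_def
    by (intro has_derivative_inverse_strong[where S = UNIV and f = G]) (auto simp: H_G fun_eq_iff)
  then show ?thesis
    by (simp add: G_H assms)
qed

text \<open>Compare both sides after applying the increasing function \<open>G\<close>, whose strict
  convexity comes from its exponential term.\<close>

lemma H_strictly_concave:
  assumes "a > 0" "b > 0" "a \<noteq> b" "0 < u" "u < 1"
  shows "u * H a + (1 - u) * H b < H (u * a + (1 - u) * b)"
proof -
  have pos: "u * a + (1 - u) * b > 0"
    using assms by (simp add: add_pos_pos)
  have "\<rho> * H a \<noteq> \<rho> * H b"
    using assms G_H[of a] G_H[of b] rho_pos by auto
  from exp_strictly_convex[OF this assms(4,5)]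
  have "G (u * H a + (1 - u) * H b) < u * G (H a) + (1 - u) * G (H b)"
    by (simp add: G_def algebra_simps)
  also have "\<dots> = G (H (u * a + (1 - u) * b))"
    using assms pos by (simp add: G_H)
  finally show ?thesis
    by (simp add: G_less_iff)
qed

section \<open>The unconstrained root and the threshold\<close>

definition psi :: "real \<Rightarrow> real" where
  "psi y = H (1 + \<theta> + \<eta> * y)"

definition t :: real where
  "t = 1 / \<rho> * ln (1 + \<theta>)"

definition R :: "real \<Rightarrow> real" where
  "R y = (if y < t then y else R_c \<theta> \<eta> \<rho> y)"

definition g :: "real \<Rightarrow> real" where
  "g y = 1 / \<rho> * ln (1 + \<theta> + \<eta> * y)"

lemma t_nonneg: "t \<ge> 0"
  using rho_pos theta_nonneg by (simp add: t_def)

lemma level_ge_1: "y \<ge> 0 \<Longrightarrow> 1 + \<theta> + \<eta> * y \<ge> 1"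
  using theta_nonneg eta_nonneg by simp

lemma level_pos: "y \<ge> 0 \<Longrightarrow> 1 + \<theta> + \<eta> * y > 0"
  using level_ge_1[of y] by simp

text \<open>Thus \<open>psi y\<close> solves the equation of \<open>R_c\<close> for every
  \<open>y \<ge> 0\<close>, without the constraint to \<open>[0, y]\<close>.\<close>

lemma G_psi: "y \<ge> 0 \<Longrightarrow> G (psi y) = 1 + \<theta> + \<eta> * y"
  by (simp add: psi_def G_H level_pos)

text \<open>Under \<open>G\<close> the comparison loses its term \<open>\<eta> * y\<close> and
  becomes \<open>exp (\<rho> * y) \<le> 1 + \<theta>\<close>; this is where the threshold
  \<open>t\<close> comes from.\<close>

lemma psi_ge_iff: "y \<ge> 0 \<Longrightarrow> y \<le> psi y \<longleftrightarrow> y \<le> t"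
proof -
  assume y: "y \<ge> 0"
  have "y \<le> psi y \<longleftrightarrow> G y \<le> 1 + \<theta> + \<eta> * y"
    using G_le_iff[of y "psi y"] G_psi[OF y] by simp
  also have "\<dots> \<longleftrightarrow> exp (\<rho> * y) \<le> exp (ln (1 + \<theta>))"
    using theta_nonneg by (simp add: G_def)
  also have "\<dots> \<longleftrightarrow> y \<le> t"
    using rho_pos by (simp only: exp_le_cancel_iff) (simp add: t_def field_simps)
  finally show ?thesis .
qed

lemma psi_le_iff: "y \<ge> 0 \<Longrightarrow> psi y \<le> y \<longleftrightarrow> t \<le> y"
proof -
  assume y: "y \<ge> 0"
  have "psi y \<le> y \<longleftrightarrow> 1 + \<theta> + \<eta> * y \<le> G y"
    using G_le_iff[of "psi y" y] G_psi[OF y] by simp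
  also have "\<dots> \<longleftrightarrow> exp (ln (1 + \<theta>)) \<le> exp (\<rho> * y)"
    using theta_nonneg by (simp add: G_def)
  also have "\<dots> \<longleftrightarrow> t \<le> y"
    using rho_pos by (simp only: exp_le_cancel_iff) (simp add: t_def field_simps)
  finally show ?thesis .
qed

lemma psi_nonneg: "y \<ge> 0 \<Longrightarrow> psi y \<ge> 0"
  using G_le_iff[of 0 "psi y"] level_ge_1[of y] by (simp add: G_psi) (simp add: G_def)

text \<open>From the threshold on, \<open>psi y\<close> satisfies the constraint to
  \<open>[0, y]\<close>; injectivity of \<open>G\<close> gives uniqueness.\<close>

lemma R_c_eq_psi:
  assumes "y \<ge> t"
  shows "R_c \<theta> \<eta> \<rho> y = psi y"
  unfolding R_c_def
proof (rule the_equality)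
  have y: "y \<ge> 0" using assms t_nonneg by simp
  show "0 \<le> psi y \<and> psi y \<le> y \<and> (1 + \<theta>) + \<eta> * y - \<eta> * psi y - exp (\<rho> * psi y) = 0"
    using psi_nonneg[OF y] psi_le_iff[OF y] assms G_psi[OF y] by (simp add: G_def)
  fix x assume "0 \<le> x \<and> x \<le> y \<and> (1 + \<theta>) + \<eta> * y - \<eta> * x - exp (\<rho> * x) = 0"
  then have "G x = 1 + \<theta> + \<eta> * y" by (simp add: G_def)
  then show "x = psi y" unfolding psi_def using H_G by metis
qed

lemma R_below: "y < t \<Longrightarrow> R y = y"
  by (simp add: R_def)

lemma R_above: "y \<ge> t \<Longrightarrow> R y = psi y"
  by (simp add: R_def R_c_eq_psi)

lemma R_t: "R t = t"
  using psi_le_iff[OF t_nonneg] psi_ge_iff[OF t_nonneg] by (simp add: R_above)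

lemma R_eq_min: "y \<ge> 0 \<Longrightarrow> R y = min y (psi y)"
  using psi_le_iff[of y] psi_ge_iff[of y] by (cases "y < t") (auto simp: R_below R_above min_def)

section \<open>Monotonicity and rates\<close>

lemma psi_mono: "0 \<le> x \<Longrightarrow> x \<le> y \<Longrightarrow> psi x \<le> psi y"
  using G_le_iff[of "psi x" "psi y"] eta_nonneg by (simp add: G_psi mult_left_mono)

lemma psi_strict_mono: "0 \<le> x \<Longrightarrow> x < y \<Longrightarrow> \<eta> > 0 \<Longrightarrow> psi x < psi y"
  using G_less_iff[of "psi x" "psi y"] by (simp add: G_psi)

text \<open>A step \<open>h\<close> in the argument raises \<open>G\<close> by at least
  \<open>\<eta> * h\<close>, which is exactly the rise of the level
  \<open>1 + \<theta> + \<eta> * y\<close>.\<close>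

lemma psi_nonexpansive:
  assumes "0 \<le> x" "x \<le> y"
  shows "psi y \<le> psi x + (y - x)"
proof -
  have "exp (\<rho> * psi x) \<le> exp (\<rho> * (psi x + (y - x)))"
    using assms rho_pos by simp
  moreover have "\<eta> * psi x + exp (\<rho> * psi x) = 1 + \<theta> + \<eta> * x"
    using G_psi[of x] assms by (simp add: G_def)
  moreover have "\<eta> * (psi x + (y - x)) = \<eta> * psi x + \<eta> * y - \<eta> * x"
    by (simp add: algebra_simps)
  ultimately have "1 + \<theta> + \<eta> * y \<le> G (psi x + (y - x))"
    unfolding G_def by linarith
  then have "G (psi y) \<le> G (psi x + (y - x))"
    using G_psi[of y] assms by simp
  then show ?thesis by (simp add: G_le_iff)
qed

lemma psi_has_derivative:
  assumes "y \<ge> 0"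
  shows "(psi has_real_derivative \<eta> / (\<eta> + \<rho> * exp (\<rho> * psi y))) (at y)"
proof -
  have "((\<lambda>y. H (1 + \<theta> + \<eta> * y)) has_real_derivative
      inverse (\<eta> + \<rho> * exp (\<rho> * H (1 + \<theta> + \<eta> * y))) * \<eta>) (at y)"
    by (rule DERIV_chain2[where g = "\<lambda>y. 1 + \<theta> + \<eta> * y",
          OF H_has_derivative[OF level_pos[OF assms]]])
      (auto intro!: derivative_eq_intros)
  then show ?thesis
    by (simp add: psi_def[abs_def] field_simps)
qed

text \<open>The rate is 0 when \<open>\<eta> = 0\<close>, since \<open>psi\<close> is then constant;
  this is why the half-open interval requires \<open>\<eta> > 0\<close>.\<close>

lemma psi_rate_bounds:
  "\<eta> / (\<eta> + \<rho> * exp (\<rho> * psi y)) \<in> {0..1}"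
  "\<eta> > 0 \<Longrightarrow> \<eta> / (\<eta> + \<rho> * exp (\<rho> * psi y)) \<in> {0<..1}"
proof -
  have "\<rho> * exp (\<rho> * psi y) > 0" using rho_pos by simp
  then show "\<eta> / (\<eta> + \<rho> * exp (\<rho> * psi y)) \<in> {0..1}"
    "\<eta> > 0 \<Longrightarrow> \<eta> / (\<eta> + \<rho> * exp (\<rho> * psi y)) \<in> {0<..1}"
    using eta_nonneg by (auto simp: field_simps)
qed

text \<open>The set \<open>S\<close> is left open so that one proof serves both
  \<open>{0..1}\<close> and \<open>{0<..1}\<close>.\<close>

lemma R_has_rates_in:
  assumes "1 \<in> S" and S: "\<And>y. \<eta> / (\<eta> + \<rho> * exp (\<rho> * psi y)) \<in> S"
  shows "has_rates_in R t S"
  unfolding has_rates_in_def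
proof (intro conjI allI impI)
  fix y :: real
  assume y: "y \<ge> 0" "y \<noteq> t"
  show "\<exists>D\<in>S. (R has_real_derivative D) (at y within {0..})"
  proof (cases "y < t")
    case True
    \<comment> \<open>\<open>R\<close> is the identity on all of \<open>{..<t}\<close>, negative
      arguments included, so even at \<open>y = 0\<close> a two-sided derivative exists.\<close>
    have "(R has_real_derivative 1) (at y)"
      by (rule DERIV_cong_ev[THEN iffD2, OF refl _ refl DERIV_ident])
        (use eventually_nhds_in_open[of "{..<t}" y] True in
          \<open>auto elim!: eventually_mono simp: R_below\<close>)
    then show ?thesis
      using assms(1) by (blast intro: has_field_derivative_at_within)
  next
    case False
    have "(R has_real_derivative \<eta> / (\<eta> + \<rho> * exp (\<rho> * psi y))) (at y)"
      by (rule DERIV_cong_ev[THEN iffD2, OF refl _ refl psi_has_derivative])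
        (use eventually_nhds_in_open[of "{t<..}" y] False y in
          \<open>auto elim!: eventually_mono simp: R_above\<close>)
    then show ?thesis
      using S by (blast intro: has_field_derivative_at_within)
  qed
next
  have "(R has_real_derivative \<eta> / (\<eta> + \<rho> * exp (\<rho> * psi t))) (at_right t)"
    by (subst has_field_derivative_cong_eventually[where g = psi])
      (auto simp: R_above eventually_at_filter
        intro: has_field_derivative_at_within psi_has_derivative t_nonneg)
  then show "\<exists>D\<in>S. (R has_real_derivative D) (at_right t)"
    using S by blast
next
  \<comment> \<open>At \<open>t\<close> itself \<open>R\<close> is given by the upper branch;
    agreement with the identity there needs \<open>R t = t\<close>.\<close>
  have "(R has_real_derivative 1) (at_left t)"
    by (subst has_field_derivative_cong_eventually[where g = "\<lambda>y. y"])
      (auto simp: R_below R_t eventually_at_filter)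
  then show "\<exists>D\<in>S. (R has_real_derivative D) (at_left t)"
    using assms(1) by blast
qed

lemma R_mono: "mono_on {0..} R"
proof (rule mono_onI)
  fix x y :: real assume "x \<in> {0..}" "x \<le> y"
  then show "R x \<le> R y"
    using psi_mono[of x y] by (auto simp: R_eq_min min_def)
qed

lemma R_strict_mono: "\<eta> > 0 \<Longrightarrow> strict_mono_on {0..} R"
proof (rule strict_mono_onI)
  fix x y :: real assume "\<eta> > 0" "x \<in> {0..}" "x < y"
  then show "R x < R y"
    using psi_strict_mono[of x y] by (auto simp: R_eq_min min_def)
qed

lemma ceded_mono: "mono_on {0..} (\<lambda>y. y - R y)"
proof (rule mono_onI)
  fix x y :: real assume "x \<in> {0..}" "x \<le> y"
  then show "x - R x \<le> y - R y"
    using psi_nonexpansive[of x y] by (auto simp: R_eq_min min_def)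
qed

section \<open>Concavity\<close>

lemma psi_strictly_concave:
  assumes "\<eta> > 0" "x \<ge> 0" "y \<ge> 0" "x \<noteq> y" "0 < u" "u < 1"
  shows "u * psi x + (1 - u) * psi y < psi (u * x + (1 - u) * y)"
proof -
  have "u * (1 + \<theta> + \<eta> * x) + (1 - u) * (1 + \<theta> + \<eta> * y) = 1 + \<theta> + \<eta> * (u * x + (1 - u) * y)"
    by (simp add: algebra_simps)
  then show ?thesis
    using H_strictly_concave[of "1 + \<theta> + \<eta> * x" "1 + \<theta> + \<eta> * y" u] assms level_pos[of x] level_pos[of y]
    by (simp add: psi_def)
qed

text \<open>Outside the strict case the two sides coincide: \<open>psi\<close> is constant, or the
  combination is trivial.\<close>

lemma psi_concave:
  assumes "x \<ge> 0" "y \<ge> 0" "0 \<le> u" "u \<le> 1"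
  shows "u * psi x + (1 - u) * psi y \<le> psi (u * x + (1 - u) * y)"
proof (cases "\<eta> > 0 \<and> x \<noteq> y \<and> 0 < u \<and> u < 1")
  case True
  then show ?thesis
    using psi_strictly_concave[of x y u] assms by simp
next
  case False
  then consider "\<eta> = 0" | "x = y" | "u = 0" | "u = 1"
    using assms eta_nonneg by fastforce
  then show ?thesis
    unfolding psi_def by cases (auto simp: algebra_simps)
qed

text \<open>A minimum of two concave functions is concave: the chord of \<open>R\<close> lies below
  the identity and below \<open>psi\<close>.\<close>

lemma R_concave: "concave_on {0..} R"
  unfolding concave_on_iff
proof (intro conjI ballI allI impI)
  fix x y u v :: real
  assume *: "x \<in> {0..}" "y \<in> {0..}" "u \<ge> 0" "v \<ge> 0" "u + v = 1"
  then have v: "v = 1 - u" by simp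
  have nonneg: "u * x + v * y \<ge> 0"
    using * by simp
  have "u * R x + v * R y \<le> u * x + v * y"
    using * by (intro add_mono mult_left_mono) (auto simp: R_eq_min)
  moreover have "u * R x + v * R y \<le> u * psi x + v * psi y"
    using * by (intro add_mono mult_left_mono) (auto simp: R_eq_min)
  ultimately show "u * R x + v * R y \<le> R (u *\<^sub>R x + v *\<^sub>R y)"
    using psi_concave[of x y u] * nonneg by (simp add: R_eq_min v)
qed simp

lemma R_strictly_concave: "\<eta> > 0 \<Longrightarrow> strictly_concave_on {t<..} R"
  unfolding strictly_concave_on_def
proof (intro conjI ballI allI impI)
  fix x y u :: real
  assume *: "\<eta> > 0" "x \<in> {t<..}" "y \<in> {t<..}" "x \<noteq> y" "0 < u" "u < 1"
  have "u * x + (1 - u) * y \<in> {t<..}"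
    using convexD[of "{t<..}" x y u "1 - u"] * by simp
  then show "u * R x + (1 - u) * R y < R (u * x + (1 - u) * y)"
    using psi_strictly_concave[of x y u] * t_nonneg by (simp add: R_above)
qed simp

section \<open>The logarithmic asymptote\<close>

lemma psi_eq_ln: "y \<ge> 0 \<Longrightarrow> psi y = 1 / \<rho> * ln (1 + \<theta> + \<eta> * y - \<eta> * psi y)"
proof -
  assume "y \<ge> 0"
  then have "1 + \<theta> + \<eta> * y - \<eta> * psi y = exp (\<rho> * psi y)"
    using G_psi[of y] by (simp add: G_def)
  then show ?thesis
    using rho_pos by simp
qed

text \<open>Drop the nonnegative term \<open>\<eta> * psi y\<close> from the equation for
  \<open>psi y\<close> and take logarithms.\<close>

lemma psi_le_g:
  assumes "y \<ge> 0"
  shows "psi y \<le> g y"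
proof -
  have "\<eta> * psi y \<ge> 0"
    using psi_nonneg[OF assms] eta_nonneg by simp
  then have "exp (\<rho> * psi y) \<le> 1 + \<theta> + \<eta> * y"
    using G_psi[OF assms] by (simp add: G_def)
  then have "\<rho> * psi y \<le> ln (1 + \<theta> + \<eta> * y)"
    using level_pos[OF assms] by (simp add: ln_ge_iff)
  then show ?thesis
    using rho_pos by (simp add: g_def field_simps)
qed

lemma R_le: "y \<ge> 0 \<Longrightarrow> R y \<le> min (g y) y"
  using psi_le_g[of y] by (auto simp: R_eq_min)

text \<open>Inserting the upper bound \<open>g\<close> for \<open>psi\<close> into the fixed-point
  form \<open>psi_eq_ln\<close> turns it into a lower bound, and the two bounds differ by a
  vanishing amount.\<close>

lemma psi_asymptote: "((\<lambda>y. psi y - g y) \<longlongrightarrow> 0) at_top"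
proof (cases "\<eta> = 0")
  case True
  have "\<forall>\<^sub>F y in at_top. psi y - g y = 0"
    using eventually_ge_at_top[of 0]
  proof eventually_elim
    case (elim y)
    then show ?case
      using psi_eq_ln[of y] True unfolding g_def by simp
  qed
  then show ?thesis
    by (rule tendsto_eventually)
next
  case False
  then have eta: "\<eta> > 0" using eta_nonneg by simp
  \<comment> \<open>With \<open>s = 1 + \<theta> + \<eta> * y\<close>, \<open>d s\<close> is the
    lower bound for \<open>psi y - g y\<close>; it vanishes at infinity because
    \<open>ln s / s\<close> tends to 0.\<close>
  define d where "d s = 1 / \<rho> * (ln (s - \<eta> / \<rho> * ln s) - ln s)" for s
  have lim: "filterlim (\<lambda>y. 1 + \<theta> + \<eta> * y) at_top at_top"
    using eta by real_asymp
  have "(d \<longlongrightarrow> 0) at_top"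
    unfolding d_def using rho_pos eta by real_asymp
  then have d: "((\<lambda>y. d (1 + \<theta> + \<eta> * y)) \<longlongrightarrow> 0) at_top"
    by (rule filterlim_compose[OF _ lim])
  \<comment> \<open>Positivity of this argument is what allows the logarithms to be compared
    below.\<close>
  have "\<forall>\<^sub>F s in at_top. s - \<eta> / \<rho> * ln s > 0"
    using rho_pos eta by real_asymp
  then have ev: "\<forall>\<^sub>F y in at_top. 1 + \<theta> + \<eta> * y - \<eta> / \<rho> * ln (1 + \<theta> + \<eta> * y) > 0"
    by (rule eventually_compose_filterlim[OF _ lim])
  show ?thesis
  proof (rule tendsto_sandwich[OF _ _ d tendsto_const])
    show "\<forall>\<^sub>F y in at_top. d (1 + \<theta> + \<eta> * y) \<le> psi y - g y"
      using ev eventually_ge_at_top[of 0]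
    proof eventually_elim
      case (elim y)
      have "\<eta> * psi y \<le> \<eta> / \<rho> * ln (1 + \<theta> + \<eta> * y)"
        using mult_left_mono[OF psi_le_g[OF elim(2)] eta_nonneg] by (simp add: g_def)
      then have "ln (1 + \<theta> + \<eta> * y - \<eta> / \<rho> * ln (1 + \<theta> + \<eta> * y))
          \<le> ln (1 + \<theta> + \<eta> * y - \<eta> * psi y)"
        using elim(1) by simp
      then have "1 / \<rho> * ln (1 + \<theta> + \<eta> * y - \<eta> / \<rho> * ln (1 + \<theta> + \<eta> * y)) \<le> psi y"
        using rho_pos by (subst psi_eq_ln[OF elim(2)]) (intro mult_left_mono, auto)
      then show ?case
        by (simp add: d_def g_def right_diff_distrib)
    qed
    show "\<forall>\<^sub>F y in at_top. psi y - g y \<le> 0"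
      using eventually_ge_at_top[of 0] by eventually_elim (simp add: psi_le_g)
  qed
qed

lemma R_asymptote: "curvilinear_asymptote R g"
  unfolding curvilinear_asymptote_def
proof (rule Lim_transform_eventually[OF psi_asymptote])
  show "\<forall>\<^sub>F y in at_top. psi y - g y = R y - g y"
    using eventually_ge_at_top[of t] by eventually_elim (simp add: R_above)
qed

end

text \<open>The strict claims are guarded by \<open>\<eta> > 0\<close>: for
  \<open>\<eta> = 0\<close> the function is \<open>min y t\<close> on \<open>y \<ge> 0\<close>, with
  rate 0 and no strict concavity beyond \<open>t\<close>.\<close>

theorem corollary4p1:
  fixes M :: "'a measure" and Y :: "'a \<Rightarrow> real" and lam \<beta> c \<theta> \<eta> :: real
  assumes "prob_space M"
    and "Y \<in> borel_measurable M"
    and "\<And>\<omega>. \<omega> \<in> space M \<Longrightarrow> Y \<omega> > 0"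
    and "cdf (distr M borel Y) 0 = 0"
    and "\<And>y. y > 0 \<Longrightarrow> 0 < cdf (distr M borel Y) y \<and> cdf (distr M borel Y) y < 1"
    and "\<exists>\<epsilon>>0. \<forall>r. \<bar>r\<bar> < \<epsilon> \<longrightarrow> integrable M (\<lambda>\<omega>. exp (r * Y \<omega>))"
    and "lam > 0" and "\<beta> > 0" and "\<theta> \<ge> 0" and "\<eta> \<ge> 0"
    and "c > lam * (LINT \<omega>|M. Y \<omega>)"
    and "kappa M Y lam c \<theta> \<eta> > 0"
  defines "\<rho> \<equiv> max_adjustment_coefficient M Y lam \<beta> c \<theta> \<eta>"
  defines "t \<equiv> 1 / \<rho> * ln (1 + \<theta>)"
  defines "R \<equiv> R_J M Y lam \<beta> c \<theta> \<eta>"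
  defines "g \<equiv> (\<lambda>y. 1 / \<rho> * ln (1 + \<theta> + \<eta> * y))"
  shows
    "(has_rates_in R t {0..1} \<and> mono_on {0..} R \<and> mono_on {0..} (\<lambda>y. y - R y) \<and>
        (\<eta> > 0 \<longrightarrow> has_rates_in R t {0<..1} \<and> strict_mono_on {0..} R)) \<and>
     (concave_on {0..} R \<and> (\<eta> > 0 \<longrightarrow> strictly_concave_on {t<..} R)) \<and>
     (curvilinear_asymptote R g \<and> (\<forall>y\<ge>0. R y \<le> min (g y) y))"
proof -
  interpret prob_space M by fact
  obtain \<epsilon> where \<epsilon>: "\<epsilon> > 0" "\<And>r. \<bar>r\<bar> < \<epsilon> \<Longrightarrow> integrable M (\<lambda>\<omega>. exp (r * Y \<omega>))"
    using assms(6) by blast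
  define r where "r = \<epsilon> / 2"
  have r: "r > 0" and int: "integrable M (\<lambda>\<omega>. exp (r * Y \<omega>))"
    using \<epsilon>(1) \<epsilon>(2)[of "\<epsilon> / 2"] by (auto simp: r_def)
  \<comment> \<open>Both bounds follow from \<open>1 + x + x^2 / 2 \<le> exp x\<close> for
    \<open>x \<ge> 0\<close>; they dominate the first two moments by the generating function at
    \<open>r\<close>.\<close>
  have exp_ge: "r * Y \<omega> \<le> exp (r * Y \<omega>)" "(r * Y \<omega>)\<^sup>2 \<le> 2 * exp (r * Y \<omega>)" if "\<omega> \<in> space M" for \<omega>
  proof -
    have "r * Y \<omega> \<ge> 0"
      using r assms(3)[OF that] by simp
    from exp_lower_Taylor_quadratic[OF this] this zero_le_power2[of "r * Y \<omega>"]
    show "r * Y \<omega> \<le> exp (r * Y \<omega>)" "(r * Y \<omega>)\<^sup>2 \<le> 2 * exp (r * Y \<omega>)"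
      by linarith+
  qed
  have "integrable M (\<lambda>\<omega>. r * Y \<omega>)"
    by (rule Bochner_Integration.integrable_bound[OF int])
      (use assms(2,3) r exp_ge in \<open>auto intro!: AE_I2 simp: abs_mult less_imp_le\<close>)
  then have intY: "integrable M Y"
    using r by simp
  have "integrable M (\<lambda>\<omega>. (r * Y \<omega>)\<^sup>2)"
    by (rule Bochner_Integration.integrable_bound[where f = "\<lambda>\<omega>. 2 * exp (r * Y \<omega>)"])
      (use assms(2) int exp_ge in auto)
  then have intY2: "integrable M (\<lambda>\<omega>. (Y \<omega>)\<^sup>2)"
    using r by (simp add: power_mult_distrib)
  interpret reinsurance M Y lam \<beta> c \<theta> \<eta>
    using assms intY intY2 by unfold_locales auto
  interpret S: retention_shape \<rho> \<theta> \<eta>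
    using max_adjustment_coefficient_pos assms(9,10) by unfold_locales (auto simp: \<rho>_def)
  have t: "t = S.t"
    by (simp add: t_def S.t_def)
  have R: "R = S.R"
    by (rule ext) (simp add: R_def R_J_def S.R_def S.t_def \<rho>_def[symmetric] Let_def)
  have g: "g = S.g"
    by (rule ext) (simp add: g_def S.g_def)
  have "has_rates_in S.R S.t {0..1}"
    by (rule S.R_has_rates_in) (use S.psi_rate_bounds(1) in auto)
  moreover have "has_rates_in S.R S.t {0<..1}" if "\<eta> > 0"
    by (rule S.R_has_rates_in) (use S.psi_rate_bounds(2)[OF that] in auto)
  ultimately show ?thesis
    unfolding t R g
    using S.R_mono S.R_strict_mono S.ceded_mono S.R_concave S.R_strictly_concave
      S.R_asymptote S.R_le by blast
qed

end
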